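(* Let $Y$ be a compact Hausdorff space, $E=C_{\mathbb{R}}(Y)$ and $P=\{f\in C_{\mathbb{R}}(Y): f(t)\ge 0 \text{ for all } t\in Y\}$. Let $(X,w)$ be a complete convex modular cone metric space (with $w:\operatorname{int}P\times X\times X\to E$). Suppose there exist a constant $k\in(0,1)$ and $c_0\in\operatorname{int}P$ such that a mapping $T:X\to X$ satisfies $$w_{kc}(Tx,Ty)\preceq w_c(x,y)\quad\text{for all } x,y\in X \text{ and all } c \text{ with } \theta\ll c\ll c_0.$$ Then $T$ has a unique fixed point.
   Context: $C_{\mathbb{R}}(Y)$ is the real Banach space of continuous real-valued functions on $Y$ with the sup-norm; $\theta$ is its zero element and $\operatorname{int}P$ is the topological interior of $P$. Write $f\preceq g$ if $g-f\in P$ (i.e. $f(t)\le g(t)$ for all $t\in Y$), and $f\ll g$ (equivalently $g\gg f$) if $g-f\in\operatorname{int}P$. Products and quotients of functions are pointwise (elements of $\operatorname{int}P$ are invertible in $C_{\mathbb{R}}(Y)$). For a nonempty set $X$, a function $w:\operatorname{int}P\times X\times X\to E$, written $w(c,x,y)=w_c(x,y)$, is a convex modular cone metric on $X$ (and $(X,w)$ is a convex modular cone metric space) if (i) for given $x,y\in X$: $w_c(x,y)=\theta$ for all $c\in\operatorname{int}P$ if and only if $x=y$; (ii) $w_c(x,y)=w_c(y,x)$ for all $x,y\in X$, $c\in\operatorname{int}P$; (iii) $w_{c_1+c_2}(x,y)\preceq \frac{c_1}{c_1+c_2}w_{c_1}(x,z)+\frac{c_2}{c_1+c_2}w_{c_2}(z,y)$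 for all $x,y,z\in X$, $c_1,c_2\in\operatorname{int}P$. A sequence $\{x_n\}$ in $X$ is modular cone convergent to $x\in X$ if for every $c\gg\theta$ there is a positive integer $N$ such that $w_c(x_n,x)\ll c$ for all $n>N$. It is a modular cone Cauchy sequence if for every $c\gg\theta$ there is a positive integer $N$ such that $w_c(x_n,x_m)\ll c$ for all $m,n>N$. $(X,w)$ is complete if every modular cone Cauchy sequence in $X$ is modular cone convergent to some point of $X$. *)

theory Defs
  imports "HOL-Analysis.Analysis"
begin

text \<open>
  The library has no separate type of continuous functions on a compact space. On a compact
  space every continuous real function is bounded, so there \<^typ>\<open>'y \<Rightarrow>\<^sub>C real\<close>, with its sup-norm,
  is the Banach space of all continuous real functions:
\<close>

lemma bcontfun_compact:
  fixes f :: "'y::topological_space \<Rightarrow> real"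
  assumes "compact (UNIV :: 'y set)"
  shows "f \<in> bcontfun \<longleftrightarrow> continuous_on UNIV f"
  using assms by (auto simp: bcontfun_def intro: compact_imp_bounded compact_continuous_image)

definition pos_cone :: "('y::topological_space \<Rightarrow>\<^sub>C real) set"
  where "pos_cone = {f. \<forall>t. apply_bcontfun f t \<ge> 0}"

definition cone_le :: "('y::topological_space \<Rightarrow>\<^sub>C real) \<Rightarrow> ('y \<Rightarrow>\<^sub>C real) \<Rightarrow> bool"
    (infix \<open>\<preceq>\<close> 50)
  where "f \<preceq> g \<longleftrightarrow> g - f \<in> pos_cone"

definition cone_less :: "('y::topological_space \<Rightarrow>\<^sub>C real) \<Rightarrow> ('y \<Rightarrow>\<^sub>C real) \<Rightarrow> bool"
    (infix \<open>\<lless>\<close> 50)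
  where "f \<lless> g \<longleftrightarrow> g - f \<in> interior pos_cone"

lemma cone_le_iff: "f \<preceq> g \<longleftrightarrow> (\<forall>t. apply_bcontfun f t \<le> apply_bcontfun g t)"
  by (simp add: cone_le_def pos_cone_def)

lemma zero_cone_less_iff: "0 \<lless> c \<longleftrightarrow> c \<in> interior pos_cone"
  by (simp add: cone_less_def)

definition bcf_mult :: "('y::topological_space \<Rightarrow>\<^sub>C real) \<Rightarrow> ('y \<Rightarrow>\<^sub>C real) \<Rightarrow> ('y \<Rightarrow>\<^sub>C real)"
    (infixl \<open>\<odot>\<close> 70)
  where "f \<odot> g = Bcontfun (\<lambda>t. apply_bcontfun f t * apply_bcontfun g t)"

text \<open>The quotient is meaningful only for a denominator in \<^term>\<open>interior pos_cone\<close>.\<close>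

definition bcf_divide :: "('y::topological_space \<Rightarrow>\<^sub>C real) \<Rightarrow> ('y \<Rightarrow>\<^sub>C real) \<Rightarrow> ('y \<Rightarrow>\<^sub>C real)"
    (infixl \<open>\<oslash>\<close> 70)
  where "f \<oslash> g = Bcontfun (\<lambda>t. apply_bcontfun f t / apply_bcontfun g t)"

lemma mult_in_bcontfun:
  fixes f g :: "'y::topological_space \<Rightarrow> real"
  assumes "f \<in> bcontfun" "g \<in> bcontfun"
  shows "(\<lambda>t. f t * g t) \<in> bcontfun"
proof -
  obtain a b where "\<And>t. \<bar>f t\<bar> \<le> a" "\<And>t. \<bar>g t\<bar> \<le> b"
    using assms by (auto simp: bcontfun_def bounded_iff)
  then have "\<bar>f t * g t\<bar> \<le> a * b" for t
    unfolding abs_mult by (meson abs_ge_zero mult_mono order_trans)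
  then show ?thesis
    using assms by (intro bcontfun_normI[where b = "a * b"])
      (auto simp: bcontfun_def intro!: continuous_intros)
qed

lemma apply_bcf_mult:
  "apply_bcontfun (f \<odot> g) t = apply_bcontfun f t * apply_bcontfun g t"
  by (simp add: bcf_mult_def Bcontfun_inverse mult_in_bcontfun apply_bcontfun)

lemma interior_pos_cone_bound:
  fixes g :: "'y::topological_space \<Rightarrow>\<^sub>C real"
  assumes "g \<in> interior pos_cone"
  shows "\<exists>e>0. \<forall>t. apply_bcontfun g t \<ge> e"
proof -
  obtain e where e: "e > 0" "cball g e \<subseteq> pos_cone"
    using assms mem_interior_cball by blast
  have "dist g (g - const_bcontfun e) \<le> e"
    using e(1) by (intro dist_bound) (simp add: dist_real_def)
  then have "g - const_bcontfun e \<in> pos_cone"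
    using e(2) by auto
  then have "apply_bcontfun g t \<ge> e" for t
    by (simp add: pos_cone_def)
  with e(1) show ?thesis
    by blast
qed

lemma apply_bcf_divide:
  fixes f g :: "'y::topological_space \<Rightarrow>\<^sub>C real"
  assumes "g \<in> interior pos_cone"
  shows "apply_bcontfun (f \<oslash> g) t = apply_bcontfun f t / apply_bcontfun g t"
proof -
  obtain e where e: "e > 0" "\<forall>t. apply_bcontfun g t \<ge> e"
    using interior_pos_cone_bound[OF assms] by blast
  have pos: "0 < apply_bcontfun g t" for t
    using e(1) e(2)[rule_format, of t] by linarith
  have bd: "norm (inverse (apply_bcontfun g t)) \<le> inverse e" for t
    using e pos[of t] by (simp add: le_imp_inverse_le)
  have "continuous_on UNIV (\<lambda>t. inverse (apply_bcontfun g t))"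
    using pos by (intro continuous_on_inverse) (auto simp: less_le)
  then have "(\<lambda>t. inverse (apply_bcontfun g t)) \<in> bcontfun"
    using bd by (rule bcontfun_normI)
  then have "(\<lambda>t. apply_bcontfun f t / apply_bcontfun g t) \<in> bcontfun"
    unfolding divide_inverse by (intro mult_in_bcontfun apply_bcontfun)
  then show ?thesis
    by (simp add: bcf_divide_def Bcontfun_inverse)
qed

text \<open>
  Functions on \<open>int P \<times> X \<times> X\<close> are total functions in the logic; only their values at
  \<open>c \<in> int P\<close> and \<open>x, y \<in> X\<close> are ever used.
\<close>

definition convex_modular_cone_metric ::
  "'x set \<Rightarrow> (('y::topological_space \<Rightarrow>\<^sub>C real) \<Rightarrow> 'x \<Rightarrow> 'x \<Rightarrow> ('y \<Rightarrow>\<^sub>C real)) \<Rightarrow> bool"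
  where "convex_modular_cone_metric X w \<longleftrightarrow>
    X \<noteq> {} \<and>
    (\<forall>x\<in>X. \<forall>y\<in>X. (\<forall>c\<in>interior pos_cone. w c x y = 0) \<longleftrightarrow> x = y) \<and>
    (\<forall>x\<in>X. \<forall>y\<in>X. \<forall>c\<in>interior pos_cone. w c x y = w c y x) \<and>
    (\<forall>x\<in>X. \<forall>y\<in>X. \<forall>z\<in>X. \<forall>c1\<in>interior pos_cone. \<forall>c2\<in>interior pos_cone.
       w (c1 + c2) x y \<preceq>
         (c1 \<oslash> (c1 + c2)) \<odot> w c1 x z + (c2 \<oslash> (c1 + c2)) \<odot> w c2 z y)"

definition modular_cone_convergent_to ::
  "(('y::topological_space \<Rightarrow>\<^sub>C real) \<Rightarrow> 'x \<Rightarrow> 'x \<Rightarrow> ('y \<Rightarrow>\<^sub>C real)) \<Rightarrow> (nat \<Rightarrow> 'x) \<Rightarrow> 'x \<Rightarrow> bool"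
  where "modular_cone_convergent_to w s x \<longleftrightarrow>
    (\<forall>c. 0 \<lless> c \<longrightarrow> (\<exists>N>0. \<forall>n>N. w c (s n) x \<lless> c))"

definition modular_cone_Cauchy ::
  "(('y::topological_space \<Rightarrow>\<^sub>C real) \<Rightarrow> 'x \<Rightarrow> 'x \<Rightarrow> ('y \<Rightarrow>\<^sub>C real)) \<Rightarrow> (nat \<Rightarrow> 'x) \<Rightarrow> bool"
  where "modular_cone_Cauchy w s \<longleftrightarrow>
    (\<forall>c. 0 \<lless> c \<longrightarrow> (\<exists>N>0. \<forall>m>N. \<forall>n>N. w c (s n) (s m) \<lless> c))"

definition modular_cone_complete ::
  "'x set \<Rightarrow> (('y::topological_space \<Rightarrow>\<^sub>C real) \<Rightarrow> 'x \<Rightarrow> 'x \<Rightarrow> ('y \<Rightarrow>\<^sub>C real)) \<Rightarrow> bool"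
  where "modular_cone_complete X w \<longleftrightarrow>
    (\<forall>s. range s \<subseteq> X \<and> modular_cone_Cauchy w s \<longrightarrow>
      (\<exists>x\<in>X. modular_cone_convergent_to w s x))"

end

theory Submission
  imports Defs
begin

text \<open>
  Write \<open>w[c]\<close> for \<open>w\<close> at the parameter \<open>c\<close>, and identify a real \<open>r > 0\<close> with the constant
  function in \<open>int P\<close>. Every element of \<open>int P\<close> dominates a small positive constant, and \<open>c \<mapsto> c w[c](x,y)\<close> is decreasing. So the Cauchy property and
  equality of points can be tested on arbitrarily small constants (\<open>modular_antimono\<close>,
  \<open>eq_if_modular_zero_at_small_constants\<close>), where the contraction hypothesis applies.

  Since \<open>k r < r\<close>, that monotonicity turns the hypothesis \<open>w[k r](T x, T y) \<preceq> w[r](x,y)\<close> into a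
  genuine contraction \<open>w[r](T x, T y) \<preceq> k w[r](x,y)\<close> at the same small parameter \<open>r\<close>
  (\<open>same_parameter_contraction\<close>), which excludes two distinct fixed points. To control a whole
  orbit, split \<open>r = (1 - k) r + k r\<close>: with \<open>y\<close> the iterate \<open>p + 1\<close> of \<open>x\<close>, convexity gives
  \<open>w[r](x,y) \<preceq> (1 - k) w[(1 - k) r](x, T x) + k w[k r](T x, y)\<close>, and by hypothesis
  \<open>w[k r](T x, y)\<close> is at most \<open>w[r]\<close> between \<open>x\<close> and its iterate \<open>p\<close>. Induction on \<open>p\<close> bounds
  \<open>w[r]\<close> between \<open>x\<close> and any of its iterates by \<open>w[(1 - k) r](x, T x)\<close> (\<open>orbit_bound\<close>). Started
  at the iterate \<open>n\<close> of a point, this bound decays like the power \<open>n\<close> of \<open>k\<close>, so the orbit is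
  Cauchy.

  For the limit \<open>x\<close> of the orbit, the same splitting through a late iterate yields only
  \<open>w[s](x, T x) \<preceq> s\<close> for small \<open>s\<close>, because convergence compares \<open>w[c]\<close> with \<open>c\<close> itself. That
  suffices: monotonicity upgrades it to \<open>r w[r](x, T x) \<preceq> s s\<close> for small \<open>r\<close> and all \<open>s < r\<close>, so
  \<open>w[r](x, T x) = 0\<close>.
\<close>

section \<open>The interior of the positive cone\<close>

lemma interior_pos_cone_iff:
  fixes g :: "'y::topological_space \<Rightarrow>\<^sub>C real"
  shows "g \<in> interior pos_cone \<longleftrightarrow> (\<exists>e>0. \<forall>t. e \<le> apply_bcontfun g t)"
proof
  assume "\<exists>e>0. \<forall>t. e \<le> apply_bcontfun g t"
  then obtain e where e: "e > 0" "\<And>t. e \<le> apply_bcontfun g t"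
    by blast
  have "ball g e \<subseteq> pos_cone"
  proof
    fix f assume "f \<in> ball g e"
    then have "dist (apply_bcontfun g t) (apply_bcontfun f t) < e" for t
      using dist_bounded[of g t f] by simp
    then have "0 \<le> apply_bcontfun f t" for t
      using e(2)[of t] by (smt (verit) dist_real_def)
    then show "f \<in> pos_cone"
      by (simp add: pos_cone_def)
  qed
  with e(1) show "g \<in> interior pos_cone"
    by (meson interior_maximal open_ball centre_in_ball subsetD)
qed (rule interior_pos_cone_bound)

lemma cone_less_iff:
  "f \<lless> g \<longleftrightarrow> (\<exists>e>0. \<forall>t. apply_bcontfun f t + e \<le> apply_bcontfun g t)"
  by (simp add: cone_less_def interior_pos_cone_iff le_diff_eq add.commute)

lemma interior_pos_cone_pos:
  "c \<in> interior pos_cone \<Longrightarrow> 0 < apply_bcontfun c t"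
  using interior_pos_cone_bound[of c] by (meson less_le_trans)

lemma const_in_interior_pos_cone:
  "0 < r \<Longrightarrow> const_bcontfun r \<in> interior pos_cone"
  by (auto simp: interior_pos_cone_iff)

lemma small_const_below:
  assumes "c \<in> interior pos_cone"
  obtains r where "0 < r" "\<And>s. s \<le> r \<Longrightarrow> const_bcontfun s \<lless> c"
proof -
  obtain e where e: "e > 0" "\<And>t. e \<le> apply_bcontfun c t"
    using interior_pos_cone_bound[OF assms] by blast
  \<comment> \<open>Half of the lower bound \<open>e\<close> of \<open>c\<close> is kept as a uniform gap.\<close>
  have "const_bcontfun s \<lless> c" if "s \<le> e / 2" for s
    unfolding cone_less_iff
  proof (intro exI[of _ "e / 2"] conjI allI)
    show "apply_bcontfun (const_bcontfun s) t + e / 2 \<le> apply_bcontfun c t" for t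
      using that e(2)[of t] by simp
  qed (use e(1) in simp)
  then show thesis
    using that[of "e / 2"] e(1) by simp
qed

section \<open>Monotonicity of convex modular cone metrics\<close>

text \<open>The convexity axiom multiplied by \<open>c\<^sub>1 + c\<^sub>2\<close>, which frees it of quotients in the function
  space.\<close>

lemma modular_triangle:
  assumes "convex_modular_cone_metric X w" "x \<in> X" "y \<in> X" "z \<in> X"
    and c: "c1 \<in> interior pos_cone" "c2 \<in> interior pos_cone"
  shows "apply_bcontfun (c1 + c2) t * apply_bcontfun (w (c1 + c2) x y) t
    \<le> apply_bcontfun c1 t * apply_bcontfun (w c1 x z) t
      + apply_bcontfun c2 t * apply_bcontfun (w c2 z y) t"
proof -
  let ?a = "apply_bcontfun c1 t" and ?b = "apply_bcontfun c2 t"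
  have pos: "0 < ?a" "0 < ?b"
    using c by (auto intro: interior_pos_cone_pos)
  obtain e1 e2 where "e1 > 0" "\<And>t. e1 \<le> apply_bcontfun c1 t"
    "e2 > 0" "\<And>t. e2 \<le> apply_bcontfun c2 t"
    using c by (meson interior_pos_cone_bound)
  then have c12: "c1 + c2 \<in> interior pos_cone"
    unfolding interior_pos_cone_iff by (intro exI[of _ "e1 + e2"]) (auto intro: add_mono)
  have "w (c1 + c2) x y \<preceq> (c1 \<oslash> (c1 + c2)) \<odot> w c1 x z + (c2 \<oslash> (c1 + c2)) \<odot> w c2 z y"
    using assms unfolding convex_modular_cone_metric_def by blast
  then have "apply_bcontfun (w (c1 + c2) x y) t
    \<le> ?a / (?a + ?b) * apply_bcontfun (w c1 x z) t + ?b / (?a + ?b) * apply_bcontfun (w c2 z y) t"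
    by (simp add: cone_le_iff apply_bcf_mult apply_bcf_divide[OF c12])
  also have "\<dots> = (?a * apply_bcontfun (w c1 x z) t + ?b * apply_bcontfun (w c2 z y) t) / (?a + ?b)"
    by (simp add: add_divide_distrib)
  finally show ?thesis
    using pos by (simp add: pos_le_divide_eq mult.commute)
qed

lemma modular_self:
  assumes "convex_modular_cone_metric X w" "x \<in> X" "c \<in> interior pos_cone"
  shows "w c x x = 0"
  using assms unfolding convex_modular_cone_metric_def by blast

lemma modular_sym:
  assumes "convex_modular_cone_metric X w" "x \<in> X" "y \<in> X" "c \<in> interior pos_cone"
  shows "w c x y = w c y x"
  using assms unfolding convex_modular_cone_metric_def by blast

text \<open>Nonnegativity comes from going from \<open>x\<close> to \<open>y\<close> and back, with equal parameters.\<close>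

lemma modular_nonneg:
  assumes m: "convex_modular_cone_metric X w" "x \<in> X" "y \<in> X" and c: "c \<in> interior pos_cone"
  shows "0 \<le> apply_bcontfun (w c x y) t"
proof -
  obtain e where "e > 0" "\<And>t. e \<le> apply_bcontfun c t"
    using interior_pos_cone_bound[OF c] by blast
  then have "c + c \<in> interior pos_cone"
    unfolding interior_pos_cone_iff by (intro exI[of _ "e + e"]) (auto intro: add_mono)
  then have "w (c + c) x x = 0"
    using m by (intro modular_self)
  then have "0 \<le> apply_bcontfun c t * apply_bcontfun (w c x y) t"
    using modular_triangle[OF m(1,2,2,3) c c, of t] modular_sym[OF m c] by simp
  then show ?thesis
    using interior_pos_cone_pos[OF c, of t] by (simp add: zero_le_mult_iff)
qed

text \<open>Convexity with the intermediate point \<open>y\<close> itself, the remaining parameter \<open>d - c\<close> being spent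
  on \<open>w(y,y) = 0\<close>.\<close>

lemma modular_scaled_antimono:
  assumes m: "convex_modular_cone_metric X w" "x \<in> X" "y \<in> X"
    and c: "c \<in> interior pos_cone" "c \<lless> d"
  shows "apply_bcontfun d t * apply_bcontfun (w d x y) t
    \<le> apply_bcontfun c t * apply_bcontfun (w c x y) t"
proof -
  have dc: "d - c \<in> interior pos_cone"
    using c(2) by (simp add: cone_less_def)
  show ?thesis
    using modular_triangle[OF m m(3) c(1) dc, of t] modular_self[OF m(1,3) dc] by simp
qed

lemma modular_antimono:
  assumes m: "convex_modular_cone_metric X w" "x \<in> X" "y \<in> X"
    and c: "c \<in> interior pos_cone" "c \<lless> d"
  shows "apply_bcontfun (w d x y) t \<le> apply_bcontfun (w c x y) t"
proof -
  have pos: "0 < apply_bcontfun c t" "apply_bcontfun c t \<le> apply_bcontfun d t"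
    using interior_pos_cone_pos[OF c(1)] interior_pos_cone_pos[of "d - c" t] c(2)
    by (simp_all add: cone_less_def)
  have "apply_bcontfun d t * apply_bcontfun (w d x y) t
    \<le> apply_bcontfun c t * apply_bcontfun (w c x y) t"
    using modular_scaled_antimono[OF assms] .
  also have "\<dots> \<le> apply_bcontfun d t * apply_bcontfun (w c x y) t"
    using pos modular_nonneg[OF m c(1)] by (intro mult_right_mono)
  finally show ?thesis
    using pos by (simp add: mult_le_cancel_left)
qed

text \<open>Every \<open>c\<close> in the interior lies above some small constant, whose metric dominates \<open>w[c]\<close>; so
  vanishing at small constants reaches all parameters, as the separation axiom requires.\<close>

lemma eq_if_modular_zero_at_small_constants:
  assumes m: "convex_modular_cone_metric X w" "x \<in> X" "y \<in> X" and "0 < r"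
    and small: "\<And>s t. 0 < s \<Longrightarrow> s \<le> r \<Longrightarrow> apply_bcontfun (w (const_bcontfun s) x y) t \<le> 0"
  shows "x = y"
proof -
  have "w c x y = 0" if c: "c \<in> interior pos_cone" for c
  proof -
    obtain q where q: "0 < q" "\<And>s. s \<le> q \<Longrightarrow> const_bcontfun s \<lless> c"
      using small_const_below[OF c] by blast
    let ?s = "min q r"
    have s: "0 < ?s"
      using q(1) \<open>0 < r\<close> by simp
    have le: "apply_bcontfun (w c x y) t \<le> 0" for t
      using modular_antimono[OF m const_in_interior_pos_cone[OF s] q(2), of t] small[OF s, of t]
      by simp
    show ?thesis
    proof (rule bcontfun_eqI)
      show "apply_bcontfun (w c x y) t = apply_bcontfun 0 t" for t
        using le[of t] modular_nonneg[OF m c, of t] by simp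
    qed
  qed
  then show ?thesis
    using m unfolding convex_modular_cone_metric_def by blast
qed

section \<open>Constant parameters\<close>

text \<open>The metric at the constant parameter \<open>r\<close>, evaluated at the point \<open>t\<close>: for each \<open>t\<close> an ordinary
  real-valued convex modular, except that it need not separate points.\<close>

definition const_modular ::
  "(('y::topological_space \<Rightarrow>\<^sub>C real) \<Rightarrow> 'x \<Rightarrow> 'x \<Rightarrow> ('y \<Rightarrow>\<^sub>C real)) \<Rightarrow> real \<Rightarrow> 'x \<Rightarrow> 'x \<Rightarrow> 'y \<Rightarrow> real"
  where "const_modular w r x y t = apply_bcontfun (w (const_bcontfun r) x y) t"

lemma const_modular_nonneg:
  assumes "convex_modular_cone_metric X w" "x \<in> X" "y \<in> X" "0 < r"
  shows "0 \<le> const_modular w r x y t"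
  using assms unfolding const_modular_def by (intro modular_nonneg const_in_interior_pos_cone)

lemma const_modular_self:
  assumes "convex_modular_cone_metric X w" "x \<in> X" "0 < r"
  shows "const_modular w r x x t = 0"
  using modular_self[OF assms(1,2) const_in_interior_pos_cone[OF assms(3)]]
  by (simp add: const_modular_def)

lemma const_modular_sym:
  assumes "convex_modular_cone_metric X w" "x \<in> X" "y \<in> X" "0 < r"
  shows "const_modular w r x y t = const_modular w r y x t"
  using modular_sym[OF assms(1-3) const_in_interior_pos_cone[OF assms(4)]]
  by (simp add: const_modular_def)

lemma const_modular_split:
  fixes w :: "('y::topological_space \<Rightarrow>\<^sub>C real) \<Rightarrow> 'x \<Rightarrow> 'x \<Rightarrow> ('y \<Rightarrow>\<^sub>C real)"
  assumes m: "convex_modular_cone_metric X w" "x \<in> X" "y \<in> X" "z \<in> X"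
    and "0 < r" "0 < a" "a < 1"
  shows "const_modular w r x y t
    \<le> (1 - a) * const_modular w ((1 - a) * r) x z t + a * const_modular w (a * r) z y t"
proof -
  have pos: "0 < (1 - a) * r" "0 < a * r"
    using assms by simp_all
  have sum: "const_bcontfun ((1 - a) * r) + const_bcontfun (a * r) = (const_bcontfun r :: 'y \<Rightarrow>\<^sub>C real)"
    by (intro bcontfun_eqI) (simp add: algebra_simps)
  have "r * const_modular w r x y t
    \<le> (1 - a) * r * const_modular w ((1 - a) * r) x z t + a * r * const_modular w (a * r) z y t"
    using modular_triangle[OF m const_in_interior_pos_cone[OF pos(1)]
      const_in_interior_pos_cone[OF pos(2)], of t]
    unfolding sum by (simp add: const_modular_def)
  also have "\<dots> = r * ((1 - a) * const_modular w ((1 - a) * r) x z t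
      + a * const_modular w (a * r) z y t)"
    by (simp add: algebra_simps)
  finally show ?thesis
    using \<open>0 < r\<close> by (simp only: mult_le_cancel_left_pos)
qed

lemma const_modular_scaled_antimono:
  fixes w :: "('y::topological_space \<Rightarrow>\<^sub>C real) \<Rightarrow> 'x \<Rightarrow> 'x \<Rightarrow> ('y \<Rightarrow>\<^sub>C real)"
  assumes m: "convex_modular_cone_metric X w" "x \<in> X" "y \<in> X" and "0 < s" "s < r"
  shows "r * const_modular w r x y t \<le> s * const_modular w s x y t"
proof -
  have lt: "const_bcontfun s \<lless> (const_bcontfun r :: 'y \<Rightarrow>\<^sub>C real)"
    unfolding cone_less_iff using \<open>s < r\<close> by (intro exI[of _ "r - s"]) simp
  show ?thesis
    using modular_scaled_antimono[OF m const_in_interior_pos_cone[OF \<open>0 < s\<close>] lt, of t]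
    by (simp add: const_modular_def)
qed

section \<open>Orbits of a contraction\<close>

text \<open>Restricting the hypothesis to small constants costs nothing, because \<open>r \<mapsto> k r\<close> and
  \<open>r \<mapsto> (1 - k) r\<close>, the only changes of parameter along an orbit, preserve small constants.\<close>

definition small_parameter_contraction ::
  "'x set \<Rightarrow> (('y::topological_space \<Rightarrow>\<^sub>C real) \<Rightarrow> 'x \<Rightarrow> 'x \<Rightarrow> ('y \<Rightarrow>\<^sub>C real)) \<Rightarrow> ('x \<Rightarrow> 'x)
    \<Rightarrow> real \<Rightarrow> real \<Rightarrow> bool"
  where "small_parameter_contraction X w T k r0 \<longleftrightarrow>
    (\<forall>x\<in>X. \<forall>y\<in>X. \<forall>r t. 0 < r \<longrightarrow> r \<le> r0 \<longrightarrow>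
      const_modular w (k * r) (T x) (T y) t \<le> const_modular w r x y t)"

text \<open>The hypothesis relates two different parameters. Scaled monotonicity takes the left-hand side
  from \<open>k r\<close> back up to \<open>r\<close>, and the ratio \<open>k\<close> of the parameters is the contraction factor.\<close>

lemma same_parameter_contraction:
  assumes m: "convex_modular_cone_metric X w" and T: "T ` X \<subseteq> X" and k: "0 < k" "k < 1"
    and contr: "small_parameter_contraction X w T k r0"
    and "x \<in> X" "y \<in> X" "0 < r" "r \<le> r0"
  shows "const_modular w r (T x) (T y) t \<le> k * const_modular w r x y t"
proof -
  have "r * const_modular w r (T x) (T y) t \<le> k * r * const_modular w (k * r) (T x) (T y) t"
    using assms by (intro const_modular_scaled_antimono) auto
  also have "\<dots> \<le> k * r * const_modular w r x y t"
    using assms unfolding small_parameter_contraction_def by (intro mult_left_mono) auto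
  also have "\<dots> = r * (k * const_modular w r x y t)"
    by simp
  finally show ?thesis
    using \<open>0 < r\<close> by (simp only: mult_le_cancel_left_pos)
qed

lemma funpow_in_invariant_set: "T ` X \<subseteq> X \<Longrightarrow> x \<in> X \<Longrightarrow> (T ^^ n) x \<in> X"
  by (induction n) auto

lemma iterates_contract:
  assumes m: "convex_modular_cone_metric X w" and T: "T ` X \<subseteq> X" and k: "0 < k" "k < 1"
    and contr: "small_parameter_contraction X w T k r0"
    and xy: "x \<in> X" "y \<in> X" and r: "0 < r" "r \<le> r0"
  shows "const_modular w r ((T ^^ n) x) ((T ^^ n) y) t \<le> k ^ n * const_modular w r x y t"
proof (induction n)
  case (Suc n)
  have "const_modular w r ((T ^^ Suc n) x) ((T ^^ Suc n) y) t
      \<le> k * const_modular w r ((T ^^ n) x) ((T ^^ n) y) t"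
    using same_parameter_contraction[OF m T k contr _ _ r] funpow_in_invariant_set[OF T] xy by simp
  also have "\<dots> \<le> k * (k ^ n * const_modular w r x y t)"
    using Suc k by (intro mult_left_mono) auto
  finally show ?case
    by simp
qed simp

text \<open>The parameter \<open>(1-k) r\<close> is spent on the first step of the orbit. What remains is \<open>k r\<close>, exactly
  the parameter at which the hypothesis compares the shifted orbit with the original one.\<close>

lemma orbit_bound:
  assumes m: "convex_modular_cone_metric X w" and T: "T ` X \<subseteq> X" and k: "0 < k" "k < 1"
    and contr: "small_parameter_contraction X w T k r0"
    and x: "x \<in> X" and r: "0 < r" "r \<le> r0"
  shows "const_modular w r x ((T ^^ p) x) t \<le> const_modular w ((1 - k) * r) x (T x) t"
proof (induction p)
  case 0
  have "T x \<in> X" "0 < (1 - k) * r"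
    using T x k r by auto
  then show ?case
    using const_modular_self[OF m x r(1), of t] const_modular_nonneg[OF m x, of "T x" "(1 - k) * r" t]
    by simp
next
  case (Suc p)
  let ?B = "const_modular w ((1 - k) * r) x (T x) t"
  have X: "T x \<in> X" "(T ^^ p) x \<in> X" "(T ^^ Suc p) x \<in> X"
    using T x funpow_in_invariant_set[OF T x, of p] by auto
  have "const_modular w r x ((T ^^ Suc p) x) t
      \<le> (1 - k) * ?B + k * const_modular w (k * r) (T x) ((T ^^ Suc p) x) t"
    using const_modular_split[OF m x X(3,1) r(1) k] .
  also have "const_modular w (k * r) (T x) ((T ^^ Suc p) x) t \<le> const_modular w r x ((T ^^ p) x) t"
    using contr x X r by (simp add: small_parameter_contraction_def)
  also have "\<dots> \<le> ?B"
    by (rule Suc)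
  finally show ?case
    using k by (simp add: algebra_simps)
qed

text \<open>By \<open>orbit_bound\<close> at the iterate \<open>n\<close>, all later iterates are as close to it as one step of the
  orbit at parameter \<open>(1 - k) r\<close>. That step shrinks by \<open>k\<close> each time, uniformly on the space since
  the metric of the very first step is a bounded function.\<close>

lemma orbit_Cauchy:
  fixes w :: "('y::topological_space \<Rightarrow>\<^sub>C real) \<Rightarrow> 'x \<Rightarrow> 'x \<Rightarrow> ('y \<Rightarrow>\<^sub>C real)"
  assumes m: "convex_modular_cone_metric X w" and T: "T ` X \<subseteq> X" and k: "0 < k" "k < 1"
    and contr: "small_parameter_contraction X w T k r0"
    and a: "a \<in> X" and r0: "0 < r0"
  shows "modular_cone_Cauchy w (\<lambda>n. (T ^^ n) a)"
  unfolding modular_cone_Cauchy_def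
proof (intro allI impI)
  fix c :: "'y \<Rightarrow>\<^sub>C real" assume "0 \<lless> c"
  then have "c \<in> interior pos_cone"
    by (simp add: zero_cone_less_iff)
  then obtain q where q: "0 < q" "\<And>s. s \<le> q \<Longrightarrow> const_bcontfun s \<lless> c"
    using small_const_below by blast
  define r where "r = min q r0"
  have r: "0 < r" "r \<le> r0" and rc: "const_bcontfun r \<lless> c"
    using q r0 by (auto simp: r_def)
  define B where "B = norm (w (const_bcontfun ((1 - k) * r)) a (T a))"
  have step: "const_modular w ((1 - k) * r) a (T a) t \<le> B" for t
    using norm_bounded[of "w (const_bcontfun ((1 - k) * r)) a (T a)" t]
    by (simp add: B_def const_modular_def)
  have r': "0 < (1 - k) * r" "(1 - k) * r \<le> r0"
    using k r by (auto intro: order_trans[OF mult_left_le_one_le])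
  have orbX: "(T ^^ n) a \<in> X" for n
    using funpow_in_invariant_set[OF T a] .
  have bound: "const_modular w r ((T ^^ n) a) ((T ^^ (n + p)) a) t \<le> k ^ n * B" for n p t
  proof -
    have "const_modular w r ((T ^^ n) a) ((T ^^ (n + p)) a) t
        = const_modular w r ((T ^^ n) a) ((T ^^ p) ((T ^^ n) a)) t"
      by (simp add: funpow_add add.commute[of n])
    also have "\<dots> \<le> const_modular w ((1 - k) * r) ((T ^^ n) a) (T ((T ^^ n) a)) t"
      using orbit_bound[OF m T k contr orbX r] .
    also have "T ((T ^^ n) a) = (T ^^ n) (T a)"
      by (simp add: funpow_swap1)
    also have "const_modular w ((1 - k) * r) ((T ^^ n) a) ((T ^^ n) (T a)) t
        \<le> k ^ n * const_modular w ((1 - k) * r) a (T a) t"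
      using iterates_contract[OF m T k contr a _ r'] T a by blast
    also have "\<dots> \<le> k ^ n * B"
      using step k by (intro mult_left_mono) auto
    finally show ?thesis .
  qed
  have "(\<lambda>n. k ^ n * B) \<longlonglongrightarrow> 0 * B"
    using k by (intro tendsto_intros LIMSEQ_power_zero) auto
  then have "eventually (\<lambda>n. k ^ n * B < r) sequentially"
    using r(1) by (intro order_tendstoD) auto
  then obtain N where N: "\<And>n. N \<le> n \<Longrightarrow> k ^ n * B < r"
    by (auto simp: eventually_sequentially)
  have close: "const_modular w r ((T ^^ n) a) ((T ^^ l) a) t \<le> r" if "N \<le> n" "N \<le> l" for n l t
  proof (cases "n \<le> l")
    case True
    then show ?thesis
      using bound[of n "l - n" t] N[OF that(1)] by simp
  next
    case False
    then show ?thesis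
      using bound[of l "n - l" t] N[OF that(2)] const_modular_sym[OF m orbX orbX r(1), of n l t]
      by simp
  qed
  have "w c ((T ^^ n) a) ((T ^^ l) a) \<lless> c" if "N \<le> n" "N \<le> l" for n l
  proof -
    obtain e where e: "e > 0" "\<And>t. r + e \<le> apply_bcontfun c t"
      using rc by (auto simp: cone_less_iff)
    have "apply_bcontfun (w c ((T ^^ n) a) ((T ^^ l) a)) t \<le> r" for t
      using modular_antimono[OF m orbX orbX const_in_interior_pos_cone[OF r(1)] rc, of n l t]
        close[OF that, of t] by (simp add: const_modular_def)
    then show ?thesis
      unfolding cone_less_iff using e by (meson add_right_mono order_trans)
  qed
  then show "\<exists>N>0. \<forall>l>N. \<forall>n>N. w c ((T ^^ n) a) ((T ^^ l) a) \<lless> c"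
    by (intro exI[of _ "Suc N"]) auto
qed

lemma const_modular_le_of_convergent:
  assumes "modular_cone_convergent_to w s x" "0 < r"
  shows "eventually (\<lambda>n. \<forall>t. const_modular w r (s n) x t \<le> r) sequentially"
proof -
  have "0 \<lless> const_bcontfun r"
    using assms(2) by (simp add: zero_cone_less_iff const_in_interior_pos_cone)
  then obtain N where N: "\<And>n. n > N \<Longrightarrow> w (const_bcontfun r) (s n) x \<lless> const_bcontfun r"
    using assms(1) unfolding modular_cone_convergent_to_def by blast
  have "const_modular w r (s n) x t \<le> r" if "n > N" for n t
    using interior_pos_cone_pos[OF N[OF that, unfolded cone_less_def], of t]
    by (simp add: const_modular_def)
  then show ?thesis
    by (intro eventually_sequentiallyI[of "Suc N"]) auto
qed

text \<open>Convergence at parameter \<open>s\<close> only brings the metric below \<open>s\<close>, not to zero, so passing to the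
  limit gives a bound by \<open>s\<close>. The bound is nevertheless decisive as \<open>s\<close> tends to zero, because the
  metric grows at least like \<open>1/s\<close> at distinct points.\<close>

lemma orbit_limit_is_fixed:
  assumes m: "convex_modular_cone_metric X w" and T: "T ` X \<subseteq> X" and k: "0 < k" "k < 1"
    and contr: "small_parameter_contraction X w T k r0"
    and a: "a \<in> X" and x: "x \<in> X" and r0: "0 < r0"
    and conv: "modular_cone_convergent_to w (\<lambda>n. (T ^^ n) a) x"
  shows "T x = x"
proof -
  have Tx: "T x \<in> X"
    using T x by auto
  have orbX: "(T ^^ n) a \<in> X" for n
    using funpow_in_invariant_set[OF T a] .
  \<comment> \<open>Go from \<open>x\<close> to a late orbit point at parameter \<open>(1 - k) s\<close>, and from there to \<open>T x\<close> at
    parameter \<open>k s\<close>, where the hypothesis applies.\<close>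
  have self_bound: "const_modular w s x (T x) t \<le> s" if s: "0 < s" "s \<le> r0" for s t
  proof -
    have s': "0 < (1 - k) * s"
      using k s by simp
    have "eventually (\<lambda>n. \<forall>t. const_modular w ((1 - k) * s) ((T ^^ Suc n) a) x t \<le> (1 - k) * s)
        sequentially"
      using const_modular_le_of_convergent[OF conv s'] by (rule eventually_compose_filterlim)
        (rule filterlim_Suc)
    moreover have "eventually (\<lambda>n. \<forall>t. const_modular w s ((T ^^ n) a) x t \<le> s) sequentially"
      using const_modular_le_of_convergent[OF conv s(1)] .
    ultimately have "eventually (\<lambda>n. const_modular w ((1 - k) * s) ((T ^^ Suc n) a) x t \<le> (1 - k) * s
        \<and> const_modular w s ((T ^^ n) a) x t \<le> s) sequentially"
      by eventually_elim blast
    then obtain n where n: "const_modular w ((1 - k) * s) ((T ^^ Suc n) a) x t \<le> (1 - k) * s"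
        "const_modular w s ((T ^^ n) a) x t \<le> s"
      using eventually_happens'[OF sequentially_bot] by blast
    have "const_modular w s x (T x) t
        \<le> (1 - k) * const_modular w ((1 - k) * s) x ((T ^^ Suc n) a) t
          + k * const_modular w (k * s) ((T ^^ Suc n) a) (T x) t"
      using const_modular_split[OF m x Tx orbX s(1) k] .
    also have "\<dots> \<le> (1 - k) * ((1 - k) * s) + k * s"
    proof (intro add_mono mult_left_mono)
      show "const_modular w ((1 - k) * s) x ((T ^^ Suc n) a) t \<le> (1 - k) * s"
        using n(1) const_modular_sym[OF m x orbX s', of "Suc n" t] by simp
      have "const_modular w (k * s) (T ((T ^^ n) a)) (T x) t \<le> const_modular w s ((T ^^ n) a) x t"
        using contr orbX[of n] x s unfolding small_parameter_contraction_def by blast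
      then show "const_modular w (k * s) ((T ^^ Suc n) a) (T x) t \<le> s"
        using n(2) by simp
    qed (use k in auto)
    also have "\<dots> \<le> (1 - k) * s + k * s"
      using k s by (intro add_mono mult_left_mono) (auto intro: mult_left_le_one_le)
    also have "\<dots> = s"
      by (simp add: algebra_simps)
    finally show ?thesis .
  qed
  \<comment> \<open>Carried up from \<open>s\<close> to \<open>r\<close> by scaled monotonicity, the bound becomes quadratic in \<open>s\<close>.\<close>
  have "const_modular w r x (T x) t \<le> 0" if r: "0 < r" "r \<le> r0" for r t
  proof -
    have "r * const_modular w r x (T x) t \<le> s * s" if s: "0 < s" "s < r" for s
    proof -
      have "r * const_modular w r x (T x) t \<le> s * const_modular w s x (T x) t"
        using const_modular_scaled_antimono[OF m x Tx s] .
      also have "\<dots> \<le> s * s"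
        using self_bound[of s t] s r by (intro mult_left_mono) auto
      finally show ?thesis .
    qed
    then have "eventually (\<lambda>s. r * const_modular w r x (T x) t \<le> s * s) (at_right 0)"
      using r(1) by (auto simp: eventually_at_right)
    moreover have "((\<lambda>s::real. s * s) \<longlongrightarrow> 0 * 0) (at_right 0)"
      by (intro tendsto_intros)
    ultimately have "r * const_modular w r x (T x) t \<le> 0 * 0"
      by (intro tendsto_lowerbound[where F = "at_right (0::real)"]) auto
    then show ?thesis
      using r(1) by (simp add: mult_le_0_iff)
  qed
  then have "x = T x"
    by (intro eq_if_modular_zero_at_small_constants[OF m x Tx r0]) (simp add: const_modular_def)
  then show ?thesis
    by simp
qed

theorem theorem3p5:
  fixes X :: "'x set"
    and w :: "('y::t2_space \<Rightarrow>\<^sub>C real) \<Rightarrow> 'x \<Rightarrow> 'x \<Rightarrow> ('y \<Rightarrow>\<^sub>C real)"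
    and T :: "'x \<Rightarrow> 'x"
    and k :: real
    and c0 :: "'y \<Rightarrow>\<^sub>C real"
  assumes "compact (UNIV :: 'y set)"
    and "convex_modular_cone_metric X w"
    and "modular_cone_complete X w"
    and "T ` X \<subseteq> X"
    and "0 < k" and "k < 1"
    and "c0 \<in> interior pos_cone"
    and "\<And>x y c. x \<in> X \<Longrightarrow> y \<in> X \<Longrightarrow> 0 \<lless> c \<Longrightarrow> c \<lless> c0 \<Longrightarrow>
           w (k *\<^sub>R c) (T x) (T y) \<preceq> w c x y"
  shows "\<exists>!x. x \<in> X \<and> T x = x"
proof -
  note m = assms(2) and complete = assms(3) and T = assms(4) and k = assms(5,6)
  obtain r0 where r0: "0 < r0" "\<And>s. s \<le> r0 \<Longrightarrow> const_bcontfun s \<lless> c0"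
    using small_const_below[OF assms(7)] by blast
  have contr: "small_parameter_contraction X w T k r0"
    unfolding small_parameter_contraction_def
  proof (intro ballI allI impI)
    fix x y r t assume xy: "x \<in> X" "y \<in> X" and r: "0 < r" "r \<le> r0"
    have "k *\<^sub>R const_bcontfun r = (const_bcontfun (k * r) :: 'y \<Rightarrow>\<^sub>C real)"
      by (intro bcontfun_eqI) simp
    moreover have "w (k *\<^sub>R const_bcontfun r) (T x) (T y) \<preceq> w (const_bcontfun r) x y"
      using xy r r0(2) by (intro assms(8)) (auto simp: zero_cone_less_iff const_in_interior_pos_cone)
    ultimately show "const_modular w (k * r) (T x) (T y) t \<le> const_modular w r x y t"
      by (simp add: const_modular_def cone_le_iff)
  qed
  have "X \<noteq> {}"
    using m unfolding convex_modular_cone_metric_def by (rule conjunct1)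
  then obtain a where a: "a \<in> X"
    by blast
  have orb: "range (\<lambda>n. (T ^^ n) a) \<subseteq> X"
    using funpow_in_invariant_set[OF T a] by (intro image_subsetI)
  obtain x where x: "x \<in> X" "modular_cone_convergent_to w (\<lambda>n. (T ^^ n) a) x"
    using complete[unfolded modular_cone_complete_def, rule_format,
        OF conjI[OF orb orbit_Cauchy[OF m T k contr a r0(1)]]] by (rule bexE)
  show ?thesis
  proof (rule ex1I[of _ x])
    show "x \<in> X \<and> T x = x"
      using x(1) orbit_limit_is_fixed[OF m T k contr a x(1) r0(1) x(2)] by simp
  next
    fix y assume y: "y \<in> X \<and> T y = y"
    have "const_modular w s y x t \<le> 0" if s: "0 < s" "s \<le> r0" for s t
    proof -
      have "const_modular w s y x t \<le> k * const_modular w s y x t"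
        using same_parameter_contraction[OF m T k contr _ x(1) s, of y t] y
          orbit_limit_is_fixed[OF m T k contr a x(1) r0(1) x(2)] by simp
      then have "(1 - k) * const_modular w s y x t \<le> 0"
        by (simp add: algebra_simps)
      then show ?thesis
        using k by (simp add: mult_le_0_iff)
    qed
    then show "y = x"
      using y x(1) by (intro eq_if_modular_zero_at_small_constants[OF m _ _ r0(1)]) (auto simp: const_modular_def)
  qed
qed

end
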